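(* Let $\sigma$ be any request sequence over a line metric with diameter $\mathrm{diam}$, and let $c_i$ denote the total cost incurred by server $i$ when serving $\sigma$ using the Double Coverage Algorithm (DCA) with $k$ servers. Then $\max_{i,j\in[k]}|c_i-c_j|=O(k\cdot\mathrm{diam})$. Thus DCA is $(1,O(k\cdot\mathrm{diam}))$-fair on line metrics.
   Context: $k$-server problem: $k$ servers in a metric space serve an online sequence of requests (points); after request $\sigma_t$ some server must be at $\sigma_t$, and moving costs the distance traveled; $c_i$ is the total distance moved by server $i$, and $\mathrm{cost}$ is $\sum_i c_i$. A line metric is a segment of the real line of length $\mathrm{diam}$ with the usual distance. Double Coverage Algorithm (DCA) on a tree (in particular a line): when a request arrives at point $r$, all servers that are unblocked (no other server lies on their shortest path to $r$) move toward $r$ at equal speed; a server that becomes blocked stops; movement halts when some server reaches $r$. On a line, if $r$ lies between two adjacent servers both move toward it until one reaches it; if $r$ lies outside all servers, the nearest one moves to it. An algorithm is $(\alpha,\beta)$-fair (with respect to its own cost) if for every request sequence every server satisfies $c_i\le \alpha\,\mathrm{cost}/k+\beta$. *)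

theory Defs
  imports "HOL-Analysis.Analysis"
begin

text \<open>
  The \<open>k\<close> servers are numbered \<open>0, \<dots>, k - 1\<close>; a configuration maps each of them to its position,
  and its values at indices \<open>\<ge> k\<close> are irrelevant. An online algorithm maps the list of requests
  seen so far to the current configuration; at the empty list it gives the initial one.
\<close>

type_synonym 'a config = "nat \<Rightarrow> 'a"

type_synonym 'a online_algorithm = "'a list \<Rightarrow> 'a config"

definition server_cost :: "'a::metric_space online_algorithm \<Rightarrow> 'a list \<Rightarrow> nat \<Rightarrow> real" where
  "server_cost A \<sigma> i = (\<Sum>t<length \<sigma>. dist (A (take t \<sigma>) i) (A (take (Suc t) \<sigma>) i))"

definition total_cost :: "nat \<Rightarrow> 'a::metric_space online_algorithm \<Rightarrow> 'a list \<Rightarrow> real" where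
  "total_cost k A \<sigma> = (\<Sum>i<k. server_cost A \<sigma> i)"

definition fair ::
    "'a::metric_space set \<Rightarrow> nat \<Rightarrow> 'a online_algorithm \<Rightarrow> real \<Rightarrow> real \<Rightarrow> bool" where
  "fair S k A \<alpha> \<beta> \<longleftrightarrow>
     (\<forall>\<sigma>. set \<sigma> \<subseteq> S \<longrightarrow> (\<forall>i<k. server_cost A \<sigma> i \<le> \<alpha> * total_cost k A \<sigma> / real k + \<beta>))"

text \<open>
  Among servers at the same point only the one facing the request may move, so Double Coverage on
  a line needs a left-to-right order of the servers: \<open>\<pi> i < \<pi> j\<close> means that server \<open>i\<close> counts as
  being to the left of server \<open>j\<close>. The order is chosen once, compatibly with the initial
  configuration, and kept for the whole run; since servers never pass each other it remains
  compatible with all later configurations. (If ties were broken arbitrarily anew at each request,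
  two servers could exchange places whenever they meet, and the costs of two servers could drift
  apart without bound.)
\<close>

definition left_to_right :: "nat \<Rightarrow> (nat \<Rightarrow> nat) \<Rightarrow> real config \<Rightarrow> bool" where
  "left_to_right k \<pi> x \<longleftrightarrow>
     inj_on \<pi> {..<k} \<and> (\<forall>i<k. \<forall>j<k. x i < x j \<longrightarrow> \<pi> i < \<pi> j)"

definition blocked :: "nat \<Rightarrow> (nat \<Rightarrow> nat) \<Rightarrow> real config \<Rightarrow> real \<Rightarrow> nat \<Rightarrow> bool" where
  "blocked k \<pi> x r i \<longleftrightarrow>
     (\<exists>j<k. j \<noteq> i \<and> x j \<in> closed_segment (x i) r \<and>
        (x j = x i \<longrightarrow> (if x i < r then \<pi> i < \<pi> j else \<pi> j < \<pi> i)))"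

definition unblocked :: "nat \<Rightarrow> (nat \<Rightarrow> nat) \<Rightarrow> real config \<Rightarrow> real \<Rightarrow> nat set" where
  "unblocked k \<pi> x r = {i. i < k \<and> \<not> blocked k \<pi> x r i}"

text \<open>
  All unblocked servers move toward \<open>r\<close> at equal speed until the first of them arrives, so each of
  them covers the distance from \<open>r\<close> to the nearest of them. On a line there is at most one
  unblocked server on each side of \<open>r\<close>, and nobody becomes blocked or unblocked before \<open>r\<close> is
  reached, so a single displacement describes the whole movement.
\<close>

definition dca_step :: "nat \<Rightarrow> (nat \<Rightarrow> nat) \<Rightarrow> real config \<Rightarrow> real \<Rightarrow> real config" where
  "dca_step k \<pi> x r =
     (let d = Min ((\<lambda>i. dist (x i) r) ` unblocked k \<pi> x r)
      in (\<lambda>i. if i \<in> unblocked k \<pi> x r then x i + sgn (r - x i) * d else x i))"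

definition dca :: "nat \<Rightarrow> (nat \<Rightarrow> nat) \<Rightarrow> real config \<Rightarrow> real online_algorithm" where
  "dca k \<pi> x\<^sub>0 \<sigma> = foldl (dca_step k \<pi>) x\<^sub>0 \<sigma>"

end

theory Submission
  imports Defs
begin

text \<open>
  If \<open>i\<close> and \<open>j\<close> are adjacent servers, \<open>i\<close> on the left, then \<open>i\<close> moves right exactly when \<open>j\<close> moves
  left, and then by the same distance. Hence in every step the displacements \<open>u\<close> of \<open>i\<close> and \<open>v\<close> of
  \<open>j\<close> satisfy \<open>\<bar>v\<bar> - \<bar>u\<bar> = u + v\<close>. Summed over the run, the right-hand side telescopes, so that the
  costs of adjacent servers differ by at most twice the diameter.
\<close>

section \<open>Movement and preservation of the order in a single step\<close>

lemma left_to_rightD: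
  assumes "left_to_right k \<pi> x" "i < k" "j < k" "\<pi> i \<le> \<pi> j"
  shows "x i \<le> x j"
  using assms unfolding left_to_right_def by (meson leD not_le)

text \<open>The common displacement \<open>d\<close> is a minimum over the distances of all
  unblocked servers, so none of them overshoots \<open>r\<close>. A server already at
  \<open>r\<close> is split off because \<open>sgn\<close> vanishes there.\<close>

lemma step_cases:
  fixes k \<pi> r and x :: "real config"
  assumes "i < k"
  defines "d \<equiv> Min ((\<lambda>i. dist (x i) r) ` unblocked k \<pi> x r)"
  obtains (still) "i \<notin> unblocked k \<pi> x r" "dca_step k \<pi> x r i = x i"
    | (at) "x i = r" "dca_step k \<pi> x r i = x i"
    | (right) "i \<in> unblocked k \<pi> x r" "x i < r" "dca_step k \<pi> x r i = x i + d" "0 \<le> d" "x i + d \<le> r"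
    | (left) "i \<in> unblocked k \<pi> x r" "r < x i" "dca_step k \<pi> x r i = x i - d" "0 \<le> d" "r \<le> x i - d"
proof (cases "i \<in> unblocked k \<pi> x r")
  case False
  then show ?thesis by (intro still) (auto simp: dca_step_def)
next
  case True
  let ?M = "(\<lambda>i. dist (x i) r) ` unblocked k \<pi> x r"
  have fin: "finite ?M" "?M \<noteq> {}"
    using True by (auto simp: unblocked_def)
  then have d: "0 \<le> d" "d \<le> \<bar>x i - r\<bar>"
    using True Min_in[OF fin] by (auto simp: d_def simp flip: dist_real_def)
  have y: "dca_step k \<pi> x r i = x i + sgn (r - x i) * d"
    using True by (simp add: dca_step_def d_def Let_def)
  consider "x i = r" | "x i < r" | "r < x i" by linarith
  then show ?thesis
  proof cases
    case 1
    then show ?thesis using y by (intro at) auto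
  next
    case 2
    then show ?thesis using y d True by (intro right) auto
  next
    case 3
    then show ?thesis using y d True by (intro left) auto
  qed
qed

lemma dca_step_between:
  assumes "i < k"
  shows "dca_step k \<pi> x r i \<in> closed_segment (x i) r"
  using assms by (cases rule: step_cases[where x = x and r = r and \<pi> = \<pi>]) (auto simp: closed_segment_eq_real_ivl)

text \<open>Servers on opposite sides of \<open>r\<close> never cross it. Of two servers on the same
  side, the one farther from \<open>r\<close> in the order is blocked and stays put, while the
  nearer one can only move away from it.\<close>

lemma left_to_right_dca_step:
  assumes ltr: "left_to_right k \<pi> x"
  shows "left_to_right k \<pi> (dca_step k \<pi> x r)"
proof -
  let ?y = "dca_step k \<pi> x r"
  have mono: "?y j \<le> ?y i" if ij: "i < k" "j < k" "\<pi> j < \<pi> i" for i j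
  proof -
    have x: "x j \<le> x i"
      using left_to_rightD[OF ltr] ij by simp
    have yi: "?y i \<in> closed_segment (x i) r" and yj: "?y j \<in> closed_segment (x j) r"
      using dca_step_between ij by auto
    consider "x j \<le> r" "r \<le> x i" | "x i < r" | "r < x j" by linarith
    then show ?thesis
    proof cases
      case 1
      then show ?thesis using yi yj by (auto simp: closed_segment_eq_real_ivl split: if_splits)
    next
      case 2
      \<comment> \<open>If the two servers coincide, \<open>\<pi> j < \<pi> i\<close> is exactly the
        tie rule that lets \<open>i\<close> block \<open>j\<close>.\<close>
      then have "blocked k \<pi> x r j"
        using x ij unfolding blocked_def
        by (intro exI[of _ i]) (auto simp: closed_segment_eq_real_ivl)
      then have "?y j = x j" by (simp add: dca_step_def unblocked_def)
      then show ?thesis using x yi 2 by (auto simp: closed_segment_eq_real_ivl split: if_splits)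
    next
      case 3
      then have "blocked k \<pi> x r i"
        using x ij unfolding blocked_def
        by (intro exI[of _ j]) (auto simp: closed_segment_eq_real_ivl)
      then have "?y i = x i" by (simp add: dca_step_def unblocked_def)
      then show ?thesis using x yj 3 by (auto simp: closed_segment_eq_real_ivl split: if_splits)
    qed
  qed
  \<comment> \<open>Strictly ordered positions exclude reversed ranks by \<open>mono\<close>; equal
    ranks are excluded by injectivity.\<close>
  have "inj_on \<pi> {..<k}"
    using ltr by (simp add: left_to_right_def)
  then show ?thesis
    unfolding left_to_right_def using mono
    by (metis inj_on_eq_iff lessThan_iff not_less_iff_gr_or_eq leD)
qed

section \<open>Adjacent servers in a single step\<close>

text \<open>Adjacency refers to ranks, not positions, so it is fixed for the whole run and makes
  sense for coinciding servers. Ranks may have gaps, hence no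
  \<open>\<pi> j = \<pi> i + 1\<close>.\<close>

definition adjacent :: "nat \<Rightarrow> (nat \<Rightarrow> nat) \<Rightarrow> nat \<Rightarrow> nat \<Rightarrow> bool" where
  "adjacent k \<pi> i j \<longleftrightarrow>
     i < k \<and> j < k \<and> \<pi> i < \<pi> j \<and> (\<forall>l<k. \<pi> l \<le> \<pi> i \<or> \<pi> j \<le> \<pi> l)"

text \<open>If \<open>j\<close> were not beyond \<open>r\<close>, it would block \<open>i\<close>. A
  server blocking \<open>j\<close> would rank below \<open>j\<close>, hence by adjacency at most as
  high as \<open>i\<close>, and so lie left of \<open>r\<close>; but a blocker lies between
  \<open>r\<close> and \<open>x j\<close>.\<close>

lemma adjacent_unblocked_right:
  assumes ltr: "left_to_right k \<pi> x" and adj: "adjacent k \<pi> i j"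
    and i: "i \<in> unblocked k \<pi> x r" "x i < r"
  shows "r < x j" "j \<in> unblocked k \<pi> x r"
proof -
  have ij: "i < k" "j < k" "\<pi> i < \<pi> j" "i \<noteq> j"
    using adj by (auto simp: adjacent_def)
  have "x i \<le> x j"
    using left_to_rightD[OF ltr] ij by simp
  show r: "r < x j"
  proof (rule ccontr)
    assume "\<not> r < x j"
    then have "blocked k \<pi> x r i"
      using ij i \<open>x i \<le> x j\<close> unfolding blocked_def
      by (intro exI[of _ j]) (auto simp: closed_segment_eq_real_ivl)
    then show False using i by (simp add: unblocked_def)
  qed
  have "\<not> blocked k \<pi> x r j"
  proof
    assume "blocked k \<pi> x r j"
    then obtain l where l: "l < k" "l \<noteq> j" "r \<le> x l" "x l \<le> x j" "x l = x j \<longrightarrow> \<pi> l < \<pi> j"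
      using r by (auto simp: blocked_def closed_segment_eq_real_ivl)
    then have "\<pi> l < \<pi> j"
      using ltr ij unfolding left_to_right_def by fastforce
    then have "x l \<le> x i"
      using left_to_rightD[OF ltr] adj l by (auto simp: adjacent_def)
    then show False using l i by simp
  qed
  then show "j \<in> unblocked k \<pi> x r" using ij by (simp add: unblocked_def)
qed

text \<open>Mirror image of the previous argument: a server blocking \<open>i\<close> would rank at
  least as high as \<open>j\<close> and so lie right of \<open>r\<close>.\<close>

lemma adjacent_unblocked_left:
  assumes ltr: "left_to_right k \<pi> x" and adj: "adjacent k \<pi> i j"
    and j: "j \<in> unblocked k \<pi> x r" "r < x j"
  shows "x i < r" "i \<in> unblocked k \<pi> x r"
proof -
  have ij: "i < k" "j < k" "\<pi> i < \<pi> j" "i \<noteq> j"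
    using adj by (auto simp: adjacent_def)
  have "x i \<le> x j"
    using left_to_rightD[OF ltr] ij by simp
  show r: "x i < r"
  proof (rule ccontr)
    assume "\<not> x i < r"
    then have "blocked k \<pi> x r j"
      using ij j \<open>x i \<le> x j\<close> unfolding blocked_def
      by (intro exI[of _ i]) (auto simp: closed_segment_eq_real_ivl)
    then show False using j by (simp add: unblocked_def)
  qed
  have "\<not> blocked k \<pi> x r i"
  proof
    assume "blocked k \<pi> x r i"
    then obtain l where l: "l < k" "l \<noteq> i" "x i \<le> x l" "x l \<le> r" "x l = x i \<longrightarrow> \<pi> i < \<pi> l"
      using r by (auto simp: blocked_def closed_segment_eq_real_ivl)
    then have "\<pi> i < \<pi> l"
      using ltr ij unfolding left_to_right_def by fastforce
    then have "x j \<le> x l"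
      using left_to_rightD[OF ltr] adj l by (auto simp: adjacent_def)
    then show False using l j by simp
  qed
  then show "i \<in> unblocked k \<pi> x r" using ij by (simp add: unblocked_def)
qed

text \<open>Either both servers close in on \<open>r\<close> by the same amount and both sides
  vanish, or \<open>i\<close> moves weakly left and \<open>j\<close> weakly right, and the absolute
  values resolve with matching signs.\<close>

lemma adjacent_displacement:
  fixes r :: real
  assumes ltr: "left_to_right k \<pi> x" and adj: "adjacent k \<pi> i j"
  defines "y \<equiv> dca_step k \<pi> x r"
  shows "\<bar>y j - x j\<bar> - \<bar>y i - x i\<bar> = (y i - x i) + (y j - x j)"
proof -
  have ij: "i < k" "j < k"
    using adj by (auto simp: adjacent_def)
  have R: "r < x j \<and> j \<in> unblocked k \<pi> x r" if "i \<in> unblocked k \<pi> x r" "x i < r"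
    using adjacent_unblocked_right[OF ltr adj that] by simp
  have L: "x i < r \<and> i \<in> unblocked k \<pi> x r" if "j \<in> unblocked k \<pi> x r" "r < x j"
    using adjacent_unblocked_left[OF ltr adj that] by simp
  show ?thesis
  proof (cases "i \<in> unblocked k \<pi> x r \<and> x i < r")
    case True
    with R have "j \<in> unblocked k \<pi> x r" "r < x j" by auto
    with True show ?thesis by (simp add: y_def dca_step_def Let_def)
  next
    case False
    with L have "\<not> (j \<in> unblocked k \<pi> x r \<and> r < x j)" by auto
    then have "x j \<le> y j"
      unfolding y_def
      by (cases rule: step_cases[OF ij(2), where x = x and r = r and \<pi> = \<pi>]) auto
    moreover have "y i \<le> x i"
      using False unfolding y_def
      by (cases rule: step_cases[OF ij(1), where x = x and r = r and \<pi> = \<pi>]) auto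
    ultimately show ?thesis by simp
  qed
qed

section \<open>Costs of adjacent servers over a whole run\<close>

lemma dca_take_Suc:
  assumes "t < length \<sigma>"
  shows "dca k \<pi> x (take (Suc t) \<sigma>) = dca_step k \<pi> (dca k \<pi> x (take t \<sigma>)) (\<sigma> ! t)"
  using assms by (simp add: dca_def take_Suc_conv_app_nth)

lemma left_to_right_dca: "left_to_right k \<pi> x \<Longrightarrow> left_to_right k \<pi> (dca k \<pi> x \<sigma>)"
  by (induction \<sigma> rule: rev_induct) (auto simp: dca_def left_to_right_dca_step)

lemma dca_in_interval:
  assumes "x i \<in> {a..b}" "i < k" "set \<sigma> \<subseteq> {a..b}"
  shows "dca k \<pi> x \<sigma> i \<in> {a..b}"
  using assms(3)
proof (induction \<sigma> rule: rev_induct)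
  case Nil
  then show ?case using assms by (simp add: dca_def)
next
  case (snoc r \<sigma>)
  \<comment> \<open>An interval is convex, so it contains the segment from the current position to
    the request.\<close>
  then have "closed_segment (dca k \<pi> x \<sigma> i) r \<subseteq> {a..b}"
    by (auto simp: closed_segment_eq_real_ivl split: if_splits)
  then show ?case
    using dca_step_between[OF assms(2), of \<pi> "dca k \<pi> x \<sigma>" r] by (auto simp: dca_def)
qed

text \<open>The displacement identity telescopes; the net displacement of each of the two servers is
  at most \<open>b - a\<close>, whence the factor 2.\<close>

lemma adjacent_cost:
  fixes x :: "real config"
  assumes ltr: "left_to_right k \<pi> x" and adj: "adjacent k \<pi> i j"
    and x: "\<forall>i<k. x i \<in> {a..b}" and \<sigma>: "set \<sigma> \<subseteq> {a..b}"
  shows "\<bar>server_cost (dca k \<pi> x) \<sigma> i - server_cost (dca k \<pi> x) \<sigma> j\<bar> \<le> 2 * (b - a)"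
proof -
  let ?z = "\<lambda>t. dca k \<pi> x (take t \<sigma>)"
  let ?n = "length \<sigma>"
  have ij: "i < k" "j < k"
    using adj by (auto simp: adjacent_def)
  have "server_cost (dca k \<pi> x) \<sigma> j - server_cost (dca k \<pi> x) \<sigma> i =
      (\<Sum>t<?n. \<bar>?z (Suc t) j - ?z t j\<bar> - \<bar>?z (Suc t) i - ?z t i\<bar>)"
    by (simp add: server_cost_def sum_subtractf dist_real_def abs_minus_commute)
  \<comment> \<open>The identity applies at every time because \<open>\<pi>\<close> stays compatible
    with all later configurations.\<close>
  also have "\<dots> = (\<Sum>t<?n. (?z (Suc t) i - ?z t i) + (?z (Suc t) j - ?z t j))"
    by (intro sum.cong refl)
      (simp add: dca_take_Suc adjacent_displacement[OF left_to_right_dca[OF ltr] adj])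
  also have "\<dots> = (?z ?n i - ?z 0 i) + (?z ?n j - ?z 0 j)"
    using sum_lessThan_telescope[of "\<lambda>t. ?z t i" ?n] sum_lessThan_telescope[of "\<lambda>t. ?z t j" ?n]
    by (simp add: sum.distrib)
  finally have eq: "server_cost (dca k \<pi> x) \<sigma> j - server_cost (dca k \<pi> x) \<sigma> i =
      (dca k \<pi> x \<sigma> i - x i) + (dca k \<pi> x \<sigma> j - x j)"
    by (simp add: dca_def)
  have "dca k \<pi> x \<sigma> i \<in> {a..b}" "dca k \<pi> x \<sigma> j \<in> {a..b}" "x i \<in> {a..b}" "x j \<in> {a..b}"
    using dca_in_interval \<sigma> x ij by blast+
  then show ?thesis using eq by (auto simp: abs_le_iff)
qed

section \<open>From adjacent servers to arbitrary pairs, and fairness\<close>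

text \<open>Triangle inequality along the chain of adjacent servers from \<open>i\<close> to
  \<open>j\<close>. The set lists the left ends of its links; the induction on the rank of
  \<open>j\<close> peels off the last link.\<close>

lemma adjacent_chain:
  fixes c :: "nat \<Rightarrow> real"
  assumes adj: "\<And>i j. adjacent k \<pi> i j \<Longrightarrow> \<bar>c i - c j\<bar> \<le> D"
    and inj: "inj_on \<pi> {..<k}"
    and ij: "i < k" "j < k" "\<pi> i \<le> \<pi> j"
  shows "\<bar>c i - c j\<bar> \<le> D * card {l. l < k \<and> \<pi> i \<le> \<pi> l \<and> \<pi> l < \<pi> j}"
  using ij
proof (induction "\<pi> j" arbitrary: j rule: less_induct)
  case less
  let ?S = "\<lambda>j. {l. l < k \<and> \<pi> i \<le> \<pi> l \<and> \<pi> l < \<pi> j}"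
  show ?case
  proof (cases "i = j")
    case True
    then have empty: "?S j = {}" by auto
    show ?thesis unfolding empty using True by simp
  next
    case False
    then have "\<pi> i < \<pi> j"
      using less.prems inj by (metis inj_on_eq_iff lessThan_iff order_le_less)
    then have "i \<in> ?S j" using less.prems by simp
    moreover have "\<forall>l. l \<in> ?S j \<longrightarrow> \<pi> l < \<pi> j" by simp
    \<comment> \<open>The witness \<open>m\<close> is the immediate predecessor of \<open>j\<close>
      in the order; \<open>i\<close> itself is a candidate.\<close>
    ultimately have "\<exists>m. m \<in> ?S j \<and> (\<forall>l. l \<in> ?S j \<longrightarrow> \<pi> l \<le> \<pi> m)"
      by (rule ex_has_greatest_nat)
    then obtain m where m: "m \<in> ?S j" and max: "\<And>l. l \<in> ?S j \<Longrightarrow> \<pi> l \<le> \<pi> m"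
      by blast
    have "adjacent k \<pi> m j"
      unfolding adjacent_def
    proof (intro conjI allI impI)
      fix l assume "l < k"
      then show "\<pi> l \<le> \<pi> m \<or> \<pi> j \<le> \<pi> l"
        using max[of l] m by force
    qed (use m less.prems in auto)
    then have step: "\<bar>c m - c j\<bar> \<le> D" by (rule adj)
    have IH: "\<bar>c i - c m\<bar> \<le> D * card (?S m)"
      by (rule less.hyps) (use m less.prems in simp_all)
    \<comment> \<open>The link from \<open>m\<close> to \<open>j\<close> adds the single left end
      \<open>m\<close>: by injectivity no other server shares its rank.\<close>
    have "?S j = insert m (?S m)"
    proof
      show "?S j \<subseteq> insert m (?S m)"
      proof
        fix l assume l: "l \<in> ?S j"
        then have "\<pi> l = \<pi> m \<longrightarrow> l = m"
          using inj m by (auto dest: inj_onD)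
        then show "l \<in> insert m (?S m)"
          using l max[OF l] by auto
      qed
    qed (use m less.prems in auto)
    then have "card (?S j) = Suc (card (?S m))"
      by (simp only:) (rule card_insert_disjoint; simp)
    then have "D * card (?S j) = D * card (?S m) + D"
      by (simp only: of_nat_Suc distrib_left mult_1_right add.commute)
    with step IH show ?thesis by linarith
  qed
qed

text \<open>A chain has at most \<open>k\<close> links, each contributing at most
  \<open>2 * (b - a)\<close>.\<close>

lemma dca_cost_difference:
  fixes x :: "real config"
  assumes ltr: "left_to_right k \<pi> x" and x: "\<forall>i<k. x i \<in> {a..b}" and \<sigma>: "set \<sigma> \<subseteq> {a..b}"
    and "a \<le> b" and ij: "i < k" "j < k"
  shows "\<bar>server_cost (dca k \<pi> x) \<sigma> i - server_cost (dca k \<pi> x) \<sigma> j\<bar> \<le> 2 * (real k * (b - a))"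
proof -
  let ?c = "server_cost (dca k \<pi> x) \<sigma>"
  have inj: "inj_on \<pi> {..<k}"
    using ltr by (simp add: left_to_right_def)
  have main: "\<bar>?c i - ?c j\<bar> \<le> 2 * (real k * (b - a))" if "i < k" "j < k" "\<pi> i \<le> \<pi> j" for i j
  proof -
    let ?S = "{l. l < k \<and> \<pi> i \<le> \<pi> l \<and> \<pi> l < \<pi> j}"
    have "card ?S \<le> card {..<k}"
      by (intro card_mono) auto
    then have "2 * (b - a) * card ?S \<le> 2 * (b - a) * real k"
      using \<open>a \<le> b\<close> by (intro mult_left_mono) auto
    moreover have "\<bar>?c i - ?c j\<bar> \<le> 2 * (b - a) * card ?S"
      by (rule adjacent_chain[OF adjacent_cost[OF ltr _ x \<sigma>] inj that])
    ultimately show ?thesis by (simp add: mult.commute mult.left_commute)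
  qed
  show ?thesis
    using main[of i j] main[of j i] ij by (cases "\<pi> i \<le> \<pi> j") (auto simp: abs_minus_commute)
qed

text \<open>The cost of \<open>i\<close> minus \<open>\<beta>\<close> is a lower bound for the cost
  of every server, hence for the average cost.\<close>

lemma fair_if_costs_close:
  assumes "k \<ge> 1"
    and close: "\<And>\<sigma> i j. set \<sigma> \<subseteq> S \<Longrightarrow> i < k \<Longrightarrow> j < k \<Longrightarrow> \<bar>server_cost A \<sigma> i - server_cost A \<sigma> j\<bar> \<le> \<beta>"
  shows "fair S k A 1 \<beta>"
  unfolding fair_def
proof (intro allI impI)
  fix \<sigma> i assume "set \<sigma> \<subseteq> S" "i < k"
  then have "(\<Sum>j<k. server_cost A \<sigma> i - \<beta>) \<le> (\<Sum>j<k. server_cost A \<sigma> j)"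
    using close by (intro sum_mono) (force simp: abs_le_iff)
  then have "real k * (server_cost A \<sigma> i - \<beta>) \<le> total_cost k A \<sigma>"
    by (simp add: total_cost_def)
  then show "server_cost A \<sigma> i \<le> 1 * total_cost k A \<sigma> / real k + \<beta>"
    using \<open>k \<ge> 1\<close> by (simp add: field_simps)
qed

theorem theorem10:
  "\<exists>C\<ge>0. \<forall>(k::nat) (a::real) (b::real) (x\<^sub>0::real config) (\<pi>::nat \<Rightarrow> nat).
     k \<ge> 1 \<longrightarrow> a \<le> b \<longrightarrow> (\<forall>i<k. x\<^sub>0 i \<in> {a..b}) \<longrightarrow> left_to_right k \<pi> x\<^sub>0 \<longrightarrow>
       (\<forall>\<sigma>. set \<sigma> \<subseteq> {a..b} \<longrightarrow>
          (MAX (i, j)\<in>{..<k} \<times> {..<k}.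
             \<bar>server_cost (dca k \<pi> x\<^sub>0) \<sigma> i - server_cost (dca k \<pi> x\<^sub>0) \<sigma> j\<bar>)
            \<le> C * (real k * (b - a))) \<and>
       fair {a..b} k (dca k \<pi> x\<^sub>0) 1 (C * (real k * (b - a)))"
\<comment> \<open>The constant 2 accounts for one diameter per server of an adjacent pair.\<close>
proof (intro exI[of _ "2::real"] conjI allI impI)
  fix k a b \<pi> \<sigma> and x\<^sub>0 :: "real config"
  assume k: "k \<ge> 1" and run: "a \<le> b" "\<forall>i<k. x\<^sub>0 i \<in> {a..b}" "left_to_right k \<pi> x\<^sub>0"
  note close = dca_cost_difference[OF run(3,2) _ run(1)]
  show "fair {a..b} k (dca k \<pi> x\<^sub>0) 1 (2 * (real k * (b - a)))"
    using k close by (rule fair_if_costs_close)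
  assume \<sigma>: "set \<sigma> \<subseteq> {a..b}"
  have "{..<k} \<times> {..<k} \<noteq> {}" using k by (auto simp: lessThan_empty_iff)
  then show "(MAX (i, j)\<in>{..<k} \<times> {..<k}.
      \<bar>server_cost (dca k \<pi> x\<^sub>0) \<sigma> i - server_cost (dca k \<pi> x\<^sub>0) \<sigma> j\<bar>) \<le> 2 * (real k * (b - a))"
    by (intro Max.boundedI) (auto intro: close[OF \<sigma>])
qed simp

end
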